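(* Let $p$ be a prime and $m\ge 0$ an integer. Let $f$ be a multiplicative arithmetic function with $f\in\mathbb{B}\{G_1(N);G_2(N)\}$, where $G_1(N)=N^{a_1}(\log N)^{b_1}$ and $G_2(N)=N^{-a_2}(\log N)^{-b_2}$, and where the exponents satisfy: either $a_1>0$ and $-\infty<b_1<\infty$, or $a_1=0$ and $0\le b_1<\infty$; and either $a_2>0$ and $-\infty<b_2<\infty$, or $a_2=0$ and $0<b_2<\infty$. Suppose there exist real numbers $\mathcal{K}>0$ and $\gamma<a_1$ and an integer $r_*\ge 0$ such that $|L_r(f;p^m)|\le \mathcal{K}p^{\gamma r}$ for all $r\ge r_*$. Then the limit $R_\infty(f,p^m)$ exists and $$R_{\infty}(f,p^m)=\sum_{r=0}^{\infty}\frac{L_r(f;p^m)}{p^{a_1r}}.$$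
   Context: An arithmetic function $f:\mathbb{Z}_{>0}\to\mathbb{R}$ is multiplicative if $f(1)=1$ and $f(k_1k_2)=f(k_1)f(k_2)$ whenever $\gcd(k_1,k_2)=1$. For a positive integer $q$ put $F\{f;N,q\}=\sum_{k\le N}f(qk)$ (sum over positive integers $k\le N$); in particular $F\{f;N,1\}=\sum_{k\le N}f(k)$. Universality class: for positive functions $G_1,G_2$ (defined for large $N$) with $G_1$ nondecreasing and $G_2(N)\to0$, $f\in\mathbb{B}\{G_1(N);G_2(N)\}$ means that there are constants $0<\mathcal{F},\mathcal{C}<\infty$ such that $\frac{F\{f;N,1\}}{\mathcal{F}G_1(N)}\to1$ as $N\to\infty$ and $\left|\frac{F\{f;N,1\}}{\mathcal{F}G_1(N)}-1\right|<\mathcal{C}\,G_2(N)$ for all sufficiently large $N$. Characteristic functions: $L_0(f;p^m)=f(p^m)$ and, for $r\ge1$, $L_r(f;p^m)=f(p^{m+r})-\sum_{j=0}^{r-1}L_j(f;p^m)f(p^{r-j})$. Renormalization function: $R_\infty(f,p^m)=\lim_{N\to\infty}\frac{F\{f;N,p^m\}}{F\{f;N,1\}}$. *)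

theory Defs
  imports Complex_Main "HOL-Computational_Algebra.Primes"
begin

text \<open>Arithmetic functions are modelled on all of \<open>nat\<close>; the value at \<open>0\<close> is unconstrained
  and never used.\<close>

definition multiplicative :: "(nat \<Rightarrow> real) \<Rightarrow> bool" where
  "multiplicative f \<longleftrightarrow>
     f 1 = 1 \<and> (\<forall>k1>0. \<forall>k2>0. coprime k1 k2 \<longrightarrow> f (k1 * k2) = f k1 * f k2)"

definition summatory :: "(nat \<Rightarrow> real) \<Rightarrow> nat \<Rightarrow> nat \<Rightarrow> real" where
  "summatory f N q = (\<Sum>k = 1..N. f (q * k))"

text \<open>The growth functions are only meaningful for large arguments (for instance a logarithmic
  factor may vanish at \<open>N = 1\<close>), so positivity and monotonicity are required only eventually.\<close>

definition universality_class ::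
  "(nat \<Rightarrow> real) \<Rightarrow> (nat \<Rightarrow> real) \<Rightarrow> (nat \<Rightarrow> real) set" where
  "universality_class G1 G2 = {f.
     (\<forall>\<^sub>F N in sequentially. G1 N > 0) \<and> (\<forall>\<^sub>F N in sequentially. G2 N > 0) \<and>
     (\<exists>N0. mono_on {N0..} G1) \<and> G2 \<longlonglongrightarrow> 0 \<and>
     (\<exists>\<F> \<C>. \<F> > 0 \<and> \<C> > 0 \<and>
        (\<lambda>N. summatory f N 1 / (\<F> * G1 N)) \<longlonglongrightarrow> 1 \<and>
        (\<forall>\<^sub>F N in sequentially. \<bar>summatory f N 1 / (\<F> * G1 N) - 1\<bar> < \<C> * G2 N))}"

text \<open>\<open>char_fun f p m r\<close> is $L_r(f;p^m)$. The case \<open>r = 0\<close> is covered by the empty sum.\<close>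

fun char_fun :: "(nat \<Rightarrow> real) \<Rightarrow> nat \<Rightarrow> nat \<Rightarrow> nat \<Rightarrow> real" where
  "char_fun f p m r =
     f (p ^ (m + r)) - (\<Sum>j\<in>{..<r}. char_fun f p m j * f (p ^ (r - j)))"

declare char_fun.simps [simp del]

text \<open>\<open>renorm f q\<close> is $R_\infty(f,q)$; it is meaningful only if \<open>renorm_ratio f q\<close> converges.\<close>

definition renorm_ratio :: "(nat \<Rightarrow> real) \<Rightarrow> nat \<Rightarrow> nat \<Rightarrow> real" where
  "renorm_ratio f q N = summatory f N q / summatory f N 1"

definition renorm :: "(nat \<Rightarrow> real) \<Rightarrow> nat \<Rightarrow> real" where
  "renorm f q = lim (renorm_ratio f q)"

end

theory Submission
  imports Defs "HOL-Analysis.Uniform_Limit"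
begin

text \<open>
  The recursion for \<open>L_r\<close> says that \<open>f (p ^ (m + i))\<close> is the convolution of \<open>L\<close> with
  \<open>j \<mapsto> f (p ^ j)\<close>. Since \<open>f\<close> is multiplicative, this lifts to the exact identity
  \<open>F{f; N, p ^ m} = (\<Sum>r. L_r * F{f; \<lfloor>N / p ^ r\<rfloor>, 1})\<close>.
  After division by \<open>F{f; N, 1}\<close> the \<open>r\<close>-th ratio tends to \<open>p powr (- a1 * r)\<close>, and it is
  \<open>O(p powr (- \<delta> * r))\<close> uniformly in \<open>N\<close> for some \<open>\<delta> > \<gamma>\<close>, because
  \<open>N powr (a1 - \<delta>) * ln N powr b1\<close> is eventually nondecreasing.
  Tannery's theorem then allows the limit to be taken termwise.
\<close>

section \<open>Convolution identity for the summatory function\<close>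

text \<open>Moving the sum of the recursion to the other side leaves \<open>char_fun f p m i\<close>
  alone; it becomes the term \<open>r = i\<close> because its factor is
  \<open>f (p ^ 0) = f 1 = 1\<close>.\<close>

lemma char_fun_convolution:
  assumes "f 1 = 1"
  shows "f (p ^ (m + i)) = (\<Sum>r\<le>i. char_fun f p m r * f (p ^ (i - r)))"
proof -
  have "char_fun f p m i = f (p ^ (m + i)) - (\<Sum>j<i. char_fun f p m j * f (p ^ (i - j)))"
    by (subst char_fun.simps) simp
  then show ?thesis
    using assms by (simp add: atMost_Suc lessThan_Suc_atMost[symmetric])
qed

text \<open>With \<open>k = p ^ i * y\<close> and \<open>y\<close> prime to \<open>p\<close>, the
  factor \<open>f y\<close> splits off both sides, and \<open>p ^ r dvd k\<close> means
  \<open>r \<le> i\<close>. What remains is the convolution identity at \<open>i\<close>.\<close>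

lemma multiplicative_prime_power_mult:
  assumes p: "prime p" and f: "multiplicative f" and k: "k > 0"
  shows "f (p ^ m * k) =
    (\<Sum>r | p ^ r dvd k. char_fun f p m r * f (k div p ^ r))"
proof -
  define i where "i = multiplicity p k"
  have nu: "\<not> is_unit p" using p by auto
  obtain y where y: "k = p ^ i * y" "\<not> p dvd y"
    using multiplicity_decompose'[of k p] k nu unfolding i_def by auto
  have y0: "y > 0" using y k by (cases y) auto
  have cop: "coprime (p ^ j) y" for j
    using p y(2) by (simp add: prime_imp_coprime)
  have mult: "f (p ^ j * y) = f (p ^ j) * f y" for j
    using f cop[of j] y0 p unfolding multiplicative_def by (simp add: prime_gt_0_nat)
  have f1: "f 1 = 1" using f unfolding multiplicative_def by simp
  have set: "{r. p ^ r dvd k} = {..i}"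
    using k nu by (auto simp: i_def power_dvd_iff_le_multiplicity)
  have "f (p ^ m * k) = f (p ^ (m + i)) * f y"
    using mult[of "m + i"] by (simp add: y(1) power_add mult.assoc)
  also have "\<dots> = (\<Sum>r\<le>i. char_fun f p m r * (f (p ^ (i - r)) * f y))"
    by (subst char_fun_convolution[of f, OF f1]) (simp add: sum_distrib_right mult.assoc)
  also have "\<dots> = (\<Sum>r\<le>i. char_fun f p m r * f (k div p ^ r))"
  proof (rule sum.cong)
    fix r assume "r \<in> {..i}"
    then have "p ^ i = p ^ r * p ^ (i - r)" by (simp flip: power_add)
    then have "k div p ^ r = p ^ (i - r) * y"
      using p by (simp add: y(1) mult.assoc prime_gt_0_nat)
    then show "char_fun f p m r * (f (p ^ (i - r)) * f y) = char_fun f p m r * f (k div p ^ r)"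
      by (simp add: mult)
  qed simp
  finally show ?thesis by (simp add: set)
qed

lemma sum_multiples:
  fixes g :: "nat \<Rightarrow> 'a::comm_monoid_add"
  assumes "d > 0"
  shows "(\<Sum>k | k \<in> {1..N} \<and> d dvd k. g (k div d)) = (\<Sum>j = 1..N div d. g j)"
proof (rule sum.reindex_bij_witness[of _ "\<lambda>j. d * j" "\<lambda>k. k div d"])
  fix k assume k: "k \<in> {k. k \<in> {1..N} \<and> d dvd k}"
  then show "k div d \<in> {1..N div d}"
    using assms by (auto simp: div_le_mono dvd_imp_le Suc_le_eq div_greater_zero_iff)
next
  fix j assume "j \<in> {1..N div d}"
  then show "d * j \<in> {k. k \<in> {1..N} \<and> d dvd k}"
    using assms by (auto simp: less_eq_div_iff_mult_less_eq mult.commute)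
qed (use assms in auto)

text \<open>Interchanging the sums over \<open>k\<close> and \<open>r\<close> turns the inner sum
  into one over the multiples of \<open>p ^ r\<close>. The range \<open>r \<le> N\<close> loses
  nothing, since \<open>r < p ^ r \<le> k \<le> N\<close> whenever \<open>p ^ r\<close> divides
  \<open>k\<close>.\<close>

lemma summatory_prime_power:
  assumes p: "prime p" and f: "multiplicative f"
  shows "summatory f N (p ^ m) =
    (\<Sum>r\<le>N. char_fun f p m r * summatory f (N div p ^ r) 1)"
proof -
  have dvd_le: "r \<le> N" if "p ^ r dvd k" "k \<in> {1..N}" for r k
  proof -
    have "r < p ^ r" using p by (intro power_gt_expt) (use prime_gt_1_nat[of p] in simp)
    also have "p ^ r \<le> N" using that dvd_imp_le[of "p ^ r" k] by auto
    finally show ?thesis by simp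
  qed
  have "summatory f N (p ^ m) =
      (\<Sum>k = 1..N. \<Sum>r | r \<in> {..N} \<and> p ^ r dvd k. char_fun f p m r * f (k div p ^ r))"
    unfolding summatory_def
  proof (rule sum.cong)
    fix k assume k: "k \<in> {1..N}"
    have "{r. p ^ r dvd k} = {r. r \<in> {..N} \<and> p ^ r dvd k}"
      using dvd_le k by auto
    then show "f (p ^ m * k) =
        (\<Sum>r | r \<in> {..N} \<and> p ^ r dvd k. char_fun f p m r * f (k div p ^ r))"
      using multiplicative_prime_power_mult[OF p f, of k] k by simp
  qed simp
  also have "\<dots> = (\<Sum>r\<le>N. \<Sum>k | k \<in> {1..N} \<and> p ^ r dvd k. char_fun f p m r * f (k div p ^ r))"
    by (rule sum.swap_restrict) auto
  also have "\<dots> = (\<Sum>r\<le>N. char_fun f p m r * summatory f (N div p ^ r) 1)"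
    using sum_multiples[of "p ^ _" f N] p
    by (simp add: summatory_def prime_gt_0_nat flip: sum_distrib_left)
  finally show ?thesis .
qed

section \<open>Regular variation and monotonicity of the growth functions\<close>

lemma tendsto_powr_ln_powr_div_ratio:
  fixes a b :: real and q :: nat
  assumes q: "q > 0"
  defines "G \<equiv> \<lambda>N::nat. real N powr a * ln (real N) powr b"
  shows "(\<lambda>N. G (N div q) / G N) \<longlonglongrightarrow> 1 / real q powr a"
proof -
  have lim: "(\<lambda>N. real (N div q) / real N) \<longlonglongrightarrow> 1 / real q"
  proof (rule tendsto_sandwich)
    show "\<forall>\<^sub>F N in sequentially. 1 / real q - 1 / real N \<le> real (N div q) / real N"
    proof (intro eventually_sequentiallyI[of 1])
      fix N :: nat assume N: "1 \<le> N"
      have "real N / real q - 1 \<le> real (N div q)"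
        using floor_correct[of "real N / real q"] by (simp add: floor_divide_of_nat_eq)
      then have "(real N / real q - 1) / real N \<le> real (N div q) / real N"
        by (rule divide_right_mono) simp
      then show "1 / real q - 1 / real N \<le> real (N div q) / real N"
        using N by (simp add: diff_divide_distrib)
    qed
    show "\<forall>\<^sub>F N in sequentially. real (N div q) / real N \<le> 1 / real q"
    proof (intro eventually_sequentiallyI[of 1])
      fix N :: nat assume N: "1 \<le> N"
      have "real (N div q) / real N \<le> (real N / real q) / real N"
        by (intro divide_right_mono of_nat_div_le_of_nat) simp
      then show "real (N div q) / real N \<le> 1 / real q" using N by simp
    qed
    show "(\<lambda>N. 1 / real q - 1 / real N) \<longlonglongrightarrow> 1 / real q"
      using tendsto_diff[OF tendsto_const lim_1_over_n] by simp
  qed simp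
  \<comment> \<open>The expression equals \<open>ln (N div q) / ln N\<close>. Its numerator
    \<open>ln (real (N div q) / real N)\<close> stays bounded, so rounding and the factor
    \<open>q\<close> do not affect the logarithmic part.\<close>
  have lnlim: "(\<lambda>N. 1 + ln (real (N div q) / real N) / ln (real N)) \<longlonglongrightarrow> 1 + 0"
    by (intro tendsto_add tendsto_const tendsto_divide_0[OF tendsto_ln[OF lim]]
        filterlim_at_top_imp_at_infinity filterlim_compose[OF ln_at_top]
        filterlim_real_sequentially) (use q in auto)
  have "(\<lambda>N. (real (N div q) / real N) powr a *
      (1 + ln (real (N div q) / real N) / ln (real N)) powr b)
      \<longlonglongrightarrow> (1 / real q) powr a * (1 + 0) powr b"
    by (intro tendsto_mult tendsto_powr lim lnlim tendsto_const) (use q in auto)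
  moreover have "\<forall>\<^sub>F N in sequentially. (real (N div q) / real N) powr a *
      (1 + ln (real (N div q) / real N) / ln (real N)) powr b = G (N div q) / G N"
  \<comment> \<open>From \<open>2 * q\<close> on, \<open>N div q \<ge> 2\<close>, so both logarithms
    are positive.\<close>
  proof (intro eventually_sequentiallyI[of "2 * q"])
    fix N assume N: "2 * q \<le> N"
    then have M: "N div q \<ge> 2" using q by (simp add: less_eq_div_iff_mult_less_eq)
    have N2: "N \<ge> 2" using M div_le_dividend[of N q] by linarith
    have lnN: "ln (real N) > 0" and lnM: "ln (real (N div q)) > 0" using N2 M by auto
    have "1 + ln (real (N div q) / real N) / ln (real N) = ln (real (N div q)) / ln (real N)"
      using lnN M N2 by (subst ln_div) (auto simp: field_simps)
    then show "(real (N div q) / real N) powr a *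
        (1 + ln (real (N div q) / real N) / ln (real N)) powr b = G (N div q) / G N"
      using lnN lnM by (simp add: G_def powr_divide)
  qed
  ultimately have "(\<lambda>N. G (N div q) / G N) \<longlonglongrightarrow> (1 / real q) powr a * (1 + 0) powr b"
    by (rule Lim_transform_eventually)
  then show ?thesis using q by (simp add: powr_divide)
qed

text \<open>In the variable \<open>u = ln N\<close> the logarithm of the function is
  \<open>e * u + b * ln u\<close>, with derivative \<open>e + b / u\<close>, nonnegative once
  \<open>e * u \<ge> \<bar>b\<bar>\<close>. For \<open>b < 0\<close> the proof replaces the
  derivative by \<open>ln v - ln u \<le> (v - u) / u\<close>.\<close>

lemma powr_ln_powr_mono:
  fixes e b :: real
  assumes e: "e > 0 \<or> (e = 0 \<and> b \<ge> 0)"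
  obtains N0 :: nat where "N0 \<ge> 3"
    "\<And>M N. N0 \<le> M \<Longrightarrow> M \<le> N \<Longrightarrow>
       real M powr e * ln (real M) powr b \<le> real N powr e * ln (real N) powr b"
proof -
  \<comment> \<open>For \<open>e = 0\<close> the quotient is 0 by convention; then
    \<open>b \<ge> 0\<close> and the threshold is irrelevant.\<close>
  obtain N1 :: nat where N1: "exp (\<bar>b\<bar> / e) \<le> real N1" using real_arch_simple by blast
  define N0 where "N0 = max 3 N1"
  have "real M powr e * ln (real M) powr b \<le> real N powr e * ln (real N) powr b"
    if M: "N0 \<le> M" and MN: "M \<le> N" for M N
  proof -
    define u v where "u = ln (real M)" and "v = ln (real N)"
    have M3: "M \<ge> 3" "N \<ge> 3" and MN1: "N1 \<le> M" using M MN by (auto simp: N0_def)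
    have u0: "u > 0" and uv: "u \<le> v" using M3 MN by (auto simp: u_def v_def)
    have "e * u + b * ln u \<le> e * v + b * ln v"
    proof (cases "b \<ge> 0")
      case True
      then show ?thesis using e u0 uv by (intro add_mono mult_left_mono) auto
    next
      case False
      then have e0: "e > 0" using e by auto
      have "\<bar>b\<bar> / e = ln (exp (\<bar>b\<bar> / e))" by simp
      also have "\<dots> \<le> u" using N1 MN1 M3 unfolding u_def by (subst ln_le_cancel_iff) (auto intro: order_trans)
      finally have be: "\<bar>b\<bar> \<le> e * u" using e0 by (simp add: field_simps)
      have "ln v - ln u = ln (v / u)" using u0 uv by (simp add: ln_div)
      also have "\<dots> \<le> (v - u) / u"
        using ln_le_minus_one[of "v / u"] u0 uv by (simp add: diff_divide_distrib)
      finally have "\<bar>b\<bar> * (ln v - ln u) \<le> \<bar>b\<bar> * ((v - u) / u)"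
        by (rule mult_left_mono) simp
      also have "\<dots> \<le> (e * u) * ((v - u) / u)"
        using be u0 uv by (intro mult_right_mono) auto
      also have "\<dots> = e * (v - u)" using u0 by simp
      finally show ?thesis using False by (simp add: algebra_simps)
    qed
    then have "exp (e * u + b * ln u) \<le> exp (e * v + b * ln v)" by simp
    then show ?thesis
      using u0 uv M3 by (simp add: powr_def u_def[symmetric] v_def[symmetric] exp_add)
  qed
  then show ?thesis using that[of N0] by (simp add: N0_def)
qed

section \<open>Bounds and limits for ratios of summatory functions\<close>

text \<open>This supplies the domination for Tannery's theorem: neither \<open>C\<close> nor the
  threshold for \<open>N\<close> depends on \<open>q\<close>, so values of \<open>q\<close>
  comparable to \<open>N\<close> or larger are covered. Splitting off \<open>N powr \<delta>\<close>
  from \<open>G\<close> leaves an eventually nondecreasing factor \<open>H\<close>.\<close>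

lemma eventually_ratio_bound:
  fixes S G :: "nat \<Rightarrow> real" and a b \<delta> F :: real
  defines "G \<equiv> \<lambda>N. real N powr a * ln (real N) powr b"
  assumes F: "F > 0" and lim: "(\<lambda>N. S N / (F * G N)) \<longlonglongrightarrow> 1" and S0: "S 0 = 0"
    and \<delta>: "\<delta> \<ge> 0" and a\<delta>: "a > \<delta> \<or> (a = \<delta> \<and> b \<ge> 0)"
  obtains C where
    "\<forall>\<^sub>F N in sequentially. \<forall>q>0. \<bar>S (N div q) / S N\<bar> \<le> C / real q powr \<delta>"
proof -
  define H where "H = (\<lambda>N. real N powr (a - \<delta>) * ln (real N) powr b)"
  have GH: "G N = real N powr \<delta> * H N" for N
    by (simp add: G_def H_def mult.assoc[symmetric] flip: powr_add)
  obtain N1 where N1: "N1 \<ge> 3" and mono: "\<And>M N. N1 \<le> M \<Longrightarrow> M \<le> N \<Longrightarrow> H M \<le> H N"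
    using powr_ln_powr_mono[of "a - \<delta>" b] a\<delta> unfolding H_def by auto
  have "\<forall>\<^sub>F N in sequentially. S N / (F * G N) \<in> {1/2<..<2}"
    using lim by (rule topological_tendstoD) auto
  then obtain N2 where N2: "\<And>N. N \<ge> N2 \<Longrightarrow> S N / (F * G N) \<in> {1/2<..<2}"
    unfolding eventually_sequentially by blast
  define N0 where "N0 = max N1 N2"
  have Hpos: "H N > 0" if "N \<ge> N0" for N
    using that N1 by (auto simp: H_def N0_def)
  have Gpos: "G N > 0" if "N \<ge> N0" for N
    using that N1 by (auto simp: G_def N0_def)
  have lower: "F / 2 * G N \<le> S N" and upper: "S N \<le> 2 * F * G N" if "N \<ge> N0" for N
    using N2[of N] Gpos[OF that] F that by (auto simp: N0_def field_simps)
  \<comment> \<open>\<open>B\<close> controls the finitely many arguments below \<open>N0\<close>,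
    where the asymptotics say nothing; dividing by \<open>H N0\<close> lets \<open>D\<close> absorb
    it, as \<open>H N0 \<le> H N\<close>.\<close>
  define B where "B = (\<Sum>M<N0. \<bar>S M\<bar>)"
  define D where "D = 2 * F + B / H N0"
  have B0: "B \<ge> 0" by (simp add: B_def sum_nonneg)
  have D0: "D \<ge> 0" using F B0 Hpos[of N0] by (simp add: D_def)
  have bound: "\<bar>S M\<bar> \<le> D * real M powr \<delta> * H N" if MN: "M \<le> N" and N: "N \<ge> N0" for M N
  proof (cases "M \<ge> N0")
    case True
    have "\<bar>S M\<bar> \<le> 2 * F * G M"
      using lower[OF True] upper[OF True] Gpos[OF True] F
      by (smt (verit) divide_pos_pos mult_pos_pos)
    also have "\<dots> = 2 * F * real M powr \<delta> * H M" by (simp add: GH)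
    also have "\<dots> \<le> D * real M powr \<delta> * H N"
      using F B0 D0 Hpos[OF True] Hpos[of N0] mono[of M N] True MN
      by (intro mult_mono) (auto simp: D_def N0_def)
    finally show ?thesis .
  next
    case False
    show ?thesis
    \<comment> \<open>The other case uses \<open>M powr \<delta> \<ge> 1\<close>, which fails at 0;
      there \<open>S0\<close> is needed.\<close>
    proof (cases "M = 0")
      case True
      then show ?thesis by (simp add: S0)
    next
      case M: False
      have "\<bar>S M\<bar> \<le> B"
        unfolding B_def using False by (intro member_le_sum) auto
      also have "\<dots> = B / H N0 * 1 * H N0" using Hpos[of N0] by simp
      also have "\<dots> \<le> D * real M powr \<delta> * H N"
        using F B0 D0 Hpos[of N0] mono[of N0 N] N M \<delta>
        by (intro mult_mono) (auto simp: D_def N0_def ge_one_powr_ge_zero)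
      finally show ?thesis .
    qed
  qed
  have "\<bar>S (N div q) / S N\<bar> \<le> (2 * D / F) / real q powr \<delta>" if N: "N \<ge> N0" and q: "q > 0" for N q
  proof -
    have N3: "N \<ge> 3" using N N1 by (simp add: N0_def)
    have "\<bar>S (N div q)\<bar> \<le> D * real (N div q) powr \<delta> * H N"
      using bound N by simp
    also have "\<dots> \<le> D * (real N / real q) powr \<delta> * H N"
      using D0 Hpos[OF N] \<delta>
      by (intro mult_right_mono mult_left_mono powr_mono2 of_nat_div_le_of_nat) auto
    also have "\<dots> = (2 * D / F) / real q powr \<delta> * (F / 2 * G N)"
      using F q by (simp add: GH powr_divide)
    also have "\<dots> \<le> (2 * D / F) / real q powr \<delta> * S N"
      using lower[OF N] D0 F by (intro mult_left_mono) auto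
    finally have *: "\<bar>S (N div q)\<bar> \<le> (2 * D / F) / real q powr \<delta> * S N" .
    have "S N > 0" using lower[OF N] Gpos[OF N] F by (smt (verit) divide_pos_pos mult_pos_pos)
    then show ?thesis using * by (simp add: abs_divide pos_divide_le_eq)
  qed
  then show ?thesis
    using that[of "2 * D / F"] eventually_sequentially by blast
qed

text \<open>Since \<open>N div q\<close> also tends to infinity, \<open>S\<close> can be replaced by
  \<open>F * G\<close> in numerator and denominator, and \<open>F\<close> cancels.\<close>

lemma tendsto_ratio_div:
  fixes S :: "nat \<Rightarrow> real" and a b F :: real and q :: nat
  defines "G \<equiv> \<lambda>N::nat. real N powr a * ln (real N) powr b"
  assumes F: "F > 0" and lim: "(\<lambda>N. S N / (F * G N)) \<longlonglongrightarrow> 1" and q: "q > 0"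
  shows "(\<lambda>N. S (N div q) / S N) \<longlonglongrightarrow> 1 / real q powr a"
proof -
  have top: "filterlim (\<lambda>N. N div q) sequentially sequentially"
    unfolding filterlim_at_top
  proof (intro allI)
    fix Z
    show "\<forall>\<^sub>F N in sequentially. Z \<le> N div q"
      using q by (intro eventually_sequentiallyI[of "Z * q"])
        (simp add: less_eq_div_iff_mult_less_eq)
  qed
  have "(\<lambda>N. (S (N div q) / (F * G (N div q))) / (S N / (F * G N)) * (G (N div q) / G N))
      \<longlonglongrightarrow> 1 / 1 * (1 / real q powr a)"
    unfolding G_def
    by (intro tendsto_mult tendsto_divide filterlim_compose[OF lim[unfolded G_def] top]
        lim[unfolded G_def] tendsto_powr_ln_powr_div_ratio q) auto
  moreover have "\<forall>\<^sub>F N in sequentially.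
      (S (N div q) / (F * G (N div q))) / (S N / (F * G N)) * (G (N div q) / G N)
      = S (N div q) / S N"
  proof (intro eventually_sequentiallyI[of "2 * q"])
    fix N assume N: "2 * q \<le> N"
    then have M: "N div q \<ge> 2" using q by (simp add: less_eq_div_iff_mult_less_eq)
    have N2: "N \<ge> 2" using M div_le_dividend[of N q] by linarith
    have "G N > 0" "G (N div q) > 0" using M N2 by (auto simp: G_def)
    then show "(S (N div q) / (F * G (N div q))) / (S N / (F * G N)) * (G (N div q) / G N)
      = S (N div q) / S N"
      using F by (simp add: field_simps)
  qed
  ultimately show ?thesis
    by (auto intro: Lim_transform_eventually)
qed

section \<open>Termwise passage to the limit\<close>

text \<open>Both \<open>lim\<close> and the infinite sum are total operators, so convergence and
  summability are asserted alongside the equation to make it meaningful.\<close>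

theorem theorem1:
  fixes p m r_star :: nat and f :: "nat \<Rightarrow> real"
    and a1 b1 a2 b2 K \<gamma> :: real
  assumes "prime p"
    and "multiplicative f"
    and "f \<in> universality_class
               (\<lambda>N. real N powr a1 * ln (real N) powr b1)
               (\<lambda>N. real N powr (- a2) * ln (real N) powr (- b2))"
    and "a1 > 0 \<or> (a1 = 0 \<and> b1 \<ge> 0)"
    and "a2 > 0 \<or> (a2 = 0 \<and> b2 > 0)"
    and "K > 0" and "\<gamma> < a1"
    and "\<And>r. r \<ge> r_star \<Longrightarrow> \<bar>char_fun f p m r\<bar> \<le> K * real p powr (\<gamma> * real r)"
  shows "convergent (renorm_ratio f (p ^ m)) \<and>
         summable (\<lambda>r. char_fun f p m r / real p powr (a1 * real r)) \<and>
         renorm f (p ^ m) = (\<Sum>r. char_fun f p m r / real p powr (a1 * real r))"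
proof -
  define L where "L = char_fun f p m"
  define S where "S = (\<lambda>N. summatory f N 1)"
  have p1: "p > 1" using assms(1) by (rule prime_gt_1_nat)
  have pow: "real (p ^ r) powr c = real p powr (c * real r)" for r c
    using p1 by (simp add: powr_realpow[symmetric] powr_powr mult.commute)
  obtain F where F: "F > 0"
    and lim: "(\<lambda>N. S N / (F * (real N powr a1 * ln (real N) powr b1))) \<longlonglongrightarrow> 1"
    using assms(3) unfolding universality_class_def S_def by auto
  \<comment> \<open>For \<open>a1 > 0\<close> the midpoint of \<open>max \<gamma> 0\<close> and
    \<open>a1\<close> works. For \<open>a1 = 0\<close> there is no room below \<open>a1\<close>, so
    \<open>\<delta> = 0\<close> is taken and \<open>b1 \<ge> 0\<close> gives the
    monotonicity.\<close>
  obtain \<delta> where \<delta>: "\<delta> \<ge> 0" "\<gamma> < \<delta>" "a1 > \<delta> \<or> (a1 = \<delta> \<and> b1 \<ge> 0)"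
  proof (cases "a1 > 0")
    case True
    then show ?thesis using assms(7) that[of "(max \<gamma> 0 + a1) / 2"] by auto
  next
    case False
    then show ?thesis using assms(4,7) that[of 0] by auto
  qed
  obtain C where C: "\<forall>\<^sub>F N in sequentially. \<forall>q>0. \<bar>S (N div q) / S N\<bar> \<le> C / real q powr \<delta>"
    using eventually_ratio_bound[OF F lim _ \<delta>(1,3)] by (auto simp: S_def summatory_def)
  define t where "t = (\<lambda>r N. L r * (S (N div p ^ r) / S N))"
  \<comment> \<open>The decay \<open>p powr (- \<delta> * r)\<close> of the ratios beats the growth
    \<open>p powr (\<gamma> * r)\<close> of \<open>L\<close>, so the majorant is geometric with
    ratio below 1.\<close>
  define M where "M = (\<lambda>r. K * C * (real p powr (\<gamma> - \<delta>)) ^ r)"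
  have t_lim: "t r \<longlonglongrightarrow> L r / real p powr (a1 * real r)" for r
    using tendsto_mult[OF tendsto_const tendsto_ratio_div[OF F lim, of "p ^ r"], of "L r"] p1
    unfolding t_def pow by simp
  have t_bound: "\<forall>\<^sub>F (r, N) in at_top \<times>\<^sub>F sequentially. norm (t r N) \<le> M r"
    unfolding eventually_prod_filter
  proof (intro exI conjI allI impI)
    show "\<forall>\<^sub>F r in at_top. r \<ge> r_star" by (rule eventually_ge_at_top)
    show "\<forall>\<^sub>F N in sequentially. \<forall>q>0. \<bar>S (N div q) / S N\<bar> \<le> C / real q powr \<delta>" by (rule C)
    fix r N assume r: "r \<ge> r_star" and N: "\<forall>q>0. \<bar>S (N div q) / S N\<bar> \<le> C / real q powr \<delta>"
    have "norm (t r N) = \<bar>L r\<bar> * \<bar>S (N div p ^ r) / S N\<bar>" by (simp add: t_def abs_mult)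
    also have "\<dots> \<le> (K * real p powr (\<gamma> * real r)) * (C / real (p ^ r) powr \<delta>)"
      using assms(6,8) r N[rule_format, of "p ^ r"] p1
      by (intro mult_mono) (auto simp: L_def)
    also have "\<dots> = K * C * real p powr ((\<gamma> - \<delta>) * real r)"
      unfolding pow by (simp add: left_diff_distrib powr_diff)
    also have "\<dots> = M r"
      using p1 by (simp add: M_def powr_realpow[symmetric] powr_powr)
    finally show "case (r, N) of (r, N) \<Rightarrow> norm (t r N) \<le> M r" by simp
  qed
  have "real p powr (\<gamma> - \<delta>) < real p powr 0"
    using p1 \<delta>(2) by (intro powr_less_mono) auto
  then have M_summable: "summable M"
    using p1 unfolding M_def by (intro summable_mult summable_geometric) simp
  have "summable (\<lambda>r. L r / real p powr (a1 * real r))"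
    and tannery: "(\<lambda>N. \<Sum>r. t r N) \<longlonglongrightarrow> (\<Sum>r. L r / real p powr (a1 * real r))"
    using tannerys_theorem[OF t_lim t_bound M_summable] by (auto intro: summable_norm_cancel)
  moreover have "(\<Sum>r. t r N) = renorm_ratio f (p ^ m) N" for N
  proof -
    \<comment> \<open>For \<open>r > N\<close> the quotient \<open>N div p ^ r\<close> is 0 and
      \<open>S 0\<close> is an empty sum, so the series is the finite sum of the exact
      identity.\<close>
    have "t r N = 0" if "r \<notin> {..N}" for r
    proof -
      have "N < r" using that by simp
      also have "r < p ^ r" using p1 by (intro power_gt_expt) simp
      finally show ?thesis by (simp add: t_def S_def summatory_def)
    qed
    then have "(\<Sum>r. t r N) = (\<Sum>r\<le>N. t r N)" by (intro suminf_finite) auto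
    also have "\<dots> = renorm_ratio f (p ^ m) N"
      by (simp add: t_def renorm_ratio_def summatory_prime_power[OF assms(1,2)] L_def S_def
          sum_divide_distrib)
    finally show ?thesis .
  qed
  ultimately show ?thesis
    unfolding renorm_def L_def by (auto simp: convergent_def limI)
qed

end
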